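(* Let $f,g\colon X\to Z$ be continuous maps. Then $$\mathrm{D}(f,g)\le \mathrm{TC}_H(f,g).$$ If, in addition, $X\times X$ is normal, then $$\mathrm{D}(f,g)\le \mathrm{TC}_H(f,g)\le \mathrm{D}(f,g)+\mathrm{TC}(X).$$
   Context: A normal space is, by definition, required to be Hausdorff. All maps are continuous, $I=[0,1]$, and path spaces carry the compact-open topology. The homotopic distance $\mathrm{D}(f,g)$ of maps $f,g\colon X\to Z$ is the least integer $k\ge 0$ such that $X$ has an open cover $U_0,\dots,U_k$ with $f|_{U_i}\simeq g|_{U_i}$ for every $i$ ($\infty$ if there is none). For maps $f\colon X\to Z$, $g\colon Y\to Z$, a subset $A\subseteq X\times Y$ is $(f,g)$-sectional if there is a continuous map $\sigma\colon A\to Z^I$ with $\sigma(x,y)(0)=f(x)$ and $\sigma(x,y)(1)=g(y)$ for all $(x,y)\in A$. The homotopy bivariate topological complexity $\mathrm{TC}_H(f,g)$ is the least integer $k\ge 0$ such that $X\times Y$ can be covered by $k+1$ open $(f,g)$-sectional subsets, and $\infty$ if no such $k$ exists (here it is used with $Y=X$). $\mathrm{TC}(X)$ is Farber's (reduced) topological complexity: the least integer $k\ge 0$ such that $X\times X$ has an open cover $U_0,\dots,U_k$ with a continuous section over each $U_i$ of $\pi_X\colon X^I\to X\times X$, $\pi_X(\gamma)=(\gamma(0),\gamma(1))$ ($\infty$ if there is none). *)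

theory Defs
  imports "HOL-Analysis.Analysis" "HOL-Library.Extended_Nat"
begin

(* Points of the mapping space are represented by extensional functions, so that two maps
   are equal as soon as they agree on the domain space. *)
definition mapping_space :: "'a topology \<Rightarrow> 'b topology \<Rightarrow> ('a \<Rightarrow> 'b) set"
  where "mapping_space X Y = {\<phi> \<in> extensional (topspace X). continuous_map X Y \<phi>}"

definition compact_open_topology :: "'a topology \<Rightarrow> 'b topology \<Rightarrow> ('a \<Rightarrow> 'b) topology"
  where "compact_open_topology X Y =
    topology_generated_by
      {{\<phi> \<in> mapping_space X Y. \<phi> ` K \<subseteq> V} | K V. compactin X K \<and> openin Y V}"

lemma topspace_compact_open_topology [simp]:
  "topspace (compact_open_topology X Y) = mapping_space X Y"
proof -
  have "mapping_space X Y = {\<phi> \<in> mapping_space X Y. \<phi> ` {} \<subseteq> {}} \<and> compactin X {} \<and> openin Y {}"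
    by simp
  then show ?thesis
    unfolding compact_open_topology_def topology_generated_by_topspace by blast
qed

definition path_space :: "'a topology \<Rightarrow> (real \<Rightarrow> 'a) topology"
  where "path_space Z = compact_open_topology (top_of_set {0..1}) Z"

definition path_endpoints :: "(real \<Rightarrow> 'a) \<Rightarrow> 'a \<times> 'a"
  where "path_endpoints \<gamma> = (\<gamma> 0, \<gamma> 1)"

(* Members of a cover may be empty or repeated. *)
definition open_cover_upto :: "'a topology \<Rightarrow> nat \<Rightarrow> (nat \<Rightarrow> 'a set) \<Rightarrow> bool"
  where "open_cover_upto X k U \<longleftrightarrow>
    (\<forall>i\<le>k. openin X (U i)) \<and> (\<Union>i\<le>k. U i) = topspace X"

(* In the three invariants below, the infimum in enat of a set of naturals is its least
   element, and is infinity when the set is empty. *)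
definition homotopic_distance ::
    "'a topology \<Rightarrow> 'b topology \<Rightarrow> ('a \<Rightarrow> 'b) \<Rightarrow> ('a \<Rightarrow> 'b) \<Rightarrow> enat"
  where "homotopic_distance X Z f g =
    Inf {enat k | k. \<exists>U. open_cover_upto X k U \<and>
           (\<forall>i\<le>k. homotopic_with (\<lambda>_. True) (subtopology X (U i)) Z f g)}"

definition sectional_subset ::
    "'a topology \<Rightarrow> 'b topology \<Rightarrow> 'c topology \<Rightarrow> ('a \<Rightarrow> 'c) \<Rightarrow> ('b \<Rightarrow> 'c) \<Rightarrow> ('a \<times> 'b) set \<Rightarrow> bool"
  where "sectional_subset X Y Z f g A \<longleftrightarrow>
    A \<subseteq> topspace (prod_topology X Y) \<and>
    (\<exists>\<sigma>. continuous_map (subtopology (prod_topology X Y) A) (path_space Z) \<sigma> \<and>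
         (\<forall>(x, y)\<in>A. \<sigma> (x, y) 0 = f x \<and> \<sigma> (x, y) 1 = g y))"

definition TC_H ::
    "'a topology \<Rightarrow> 'b topology \<Rightarrow> 'c topology \<Rightarrow> ('a \<Rightarrow> 'c) \<Rightarrow> ('b \<Rightarrow> 'c) \<Rightarrow> enat"
  where "TC_H X Y Z f g =
    Inf {enat k | k. \<exists>U. open_cover_upto (prod_topology X Y) k U \<and>
           (\<forall>i\<le>k. sectional_subset X Y Z f g (U i))}"

definition TC :: "'a topology \<Rightarrow> enat"
  where "TC X =
    Inf {enat k | k. \<exists>U. open_cover_upto (prod_topology X X) k U \<and>
           (\<forall>i\<le>k. \<exists>s. continuous_map (subtopology (prod_topology X X) (U i)) (path_space X) s \<and>
                      (\<forall>p\<in>U i. path_endpoints (s p) = p))}"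

end

theory Submission
  imports Defs
begin

text \<open>Since the unit interval is compact Hausdorff, a continuous map into a path space is the same
  as a homotopy. Hence a subset \<open>A\<close> of the product is \<open>(f, g)\<close>-sectional exactly when \<open>f \<circ> fst\<close> and \<open>g \<circ> snd\<close> are
  homotopic on \<open>A\<close> (\<open>sectional_subset_iff_homotopic\<close>); in particular \<open>TC X\<close> is the invariant
  \<open>TC_H\<close> of the pair \<open>(id, id)\<close>. Everything then follows from formal properties of homotopies.

  For the lower bound, a cover of \<open>X \<times> X\<close> by sectional sets is pulled back along the diagonal
  \<open>x \<mapsto> (x, x)\<close>, which turns \<open>f \<circ> fst\<close> and \<open>g \<circ> snd\<close> into \<open>f\<close> and \<open>g\<close>.

  For the upper bound, let \<open>f\<close> and \<open>g\<close> be homotopic on each of \<open>U 0, \<dots>, U m\<close>, which cover \<open>X\<close>, and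
  \<open>fst\<close> and \<open>snd\<close> on each of \<open>V 0, \<dots>, V n\<close>, which cover \<open>X \<times> X\<close>. On an open subset of
  \<open>(U i \<times> X) \<inter> V j\<close> there are homotopies from \<open>f \<circ> fst\<close> to \<open>g \<circ> fst\<close> and on to \<open>g \<circ> snd\<close>. It
  remains to cover \<open>X \<times> X\<close> by only \<open>m + n + 1\<close> sets, each a disjoint union of such open subsets
  (\<open>normal_space_combine_covers\<close>), as homotopies on disjoint open sets can be glued. By normality,
  each of the two covers has functions into \<open>[0, 1]\<close>, vanishing off the respective sets, whose
  maximum is 1 at every point. Every point determines the set of those indices, from both covers,
  at which the value is 1. The points where the functions indexed by a given set \<open>P\<close> strictly
  dominate all others form an open set, and these open sets are disjoint for distinct \<open>P\<close> of the
  same cardinality; so one groups them by cardinality.\<close>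

section \<open>Paths in the compact-open topology and homotopies\<close>

text \<open>The compact neighbourhood base of \<open>X\<close> makes evaluation continuous: near \<open>(t, w)\<close>, the maps
  that send a compact neighbourhood of \<open>t\<close> into \<open>V\<close> form a subbasic open set.\<close>

lemma compact_open_continuous_imp_uncurry:
  assumes X: "neighbourhood_base_of (compactin X) X"
    and \<sigma>: "continuous_map W (compact_open_topology X Z) \<sigma>"
  shows "continuous_map (prod_topology X W) Z (\<lambda>(t, w). \<sigma> w t)"
proof -
  have sig: "continuous_map X Z (\<sigma> w)" if "w \<in> topspace W" for w
    using continuous_map_funspace [OF \<sigma>] that by (auto simp: mapping_space_def)
  show ?thesis
    unfolding continuous_map_def
  proof (intro conjI allI impI)
    show "(\<lambda>(t, w). \<sigma> w t) \<in> topspace (prod_topology X W) \<rightarrow> topspace Z"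
      using sig by (fastforce simp: continuous_map_def)
  next
    fix V
    assume V: "openin Z V"
    show "openin (prod_topology X W)
            {p \<in> topspace (prod_topology X W). (case p of (t, w) \<Rightarrow> \<sigma> w t) \<in> V}"
      unfolding openin_prod_topology_alt
    proof (intro allI impI)
      fix t w
      assume "(t, w) \<in> {p \<in> topspace (prod_topology X W). (case p of (t, w) \<Rightarrow> \<sigma> w t) \<in> V}"
      then have t: "t \<in> topspace X" and w: "w \<in> topspace W" and tw: "\<sigma> w t \<in> V"
        by auto
      have "openin X {t \<in> topspace X. \<sigma> w t \<in> V}"
        using sig [OF w] V by (rule openin_continuous_map_preimage)
      then obtain T K where T: "openin X T" "compactin X K" "t \<in> T" "T \<subseteq> K"
        and K: "K \<subseteq> {t \<in> topspace X. \<sigma> w t \<in> V}"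
        using X t tw unfolding neighbourhood_base_of by (metis (mono_tags, lifting) mem_Collect_eq)
      let ?S = "{\<phi> \<in> mapping_space X Z. \<phi> ` K \<subseteq> V}"
      let ?N = "{w \<in> topspace W. \<sigma> w \<in> ?S}"
      have "openin (compact_open_topology X Z) ?S"
        unfolding compact_open_topology_def using T V by (intro topology_generated_by_Basis) blast
      then have "openin W ?N"
        using \<sigma> by (rule openin_continuous_map_preimage [rotated])
      moreover have "w \<in> ?N"
        using w K continuous_map_funspace [OF \<sigma>] by auto
      moreover have "T \<times> ?N
          \<subseteq> {p \<in> topspace (prod_topology X W). (case p of (t, w) \<Rightarrow> \<sigma> w t) \<in> V}"
        using T openin_subset by fastforce
      ultimately show "\<exists>U N. openin X U \<and> openin W N \<and> t \<in> U \<and> w \<in> N \<and>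
          U \<times> N \<subseteq> {p \<in> topspace (prod_topology X W). (case p of (t, w) \<Rightarrow> \<sigma> w t) \<in> V}"
        using T by blast
    qed
  qed
qed

lemma continuous_imp_curry_compact_open:
  assumes h: "continuous_map (prod_topology X W) Z h"
  shows "continuous_map W (compact_open_topology X Z) (\<lambda>w. restrict (\<lambda>t. h (t, w)) (topspace X))"
    (is "continuous_map W _ ?\<sigma>")
proof -
  have cont: "continuous_map X Z (\<lambda>t. h (t, w))" if "w \<in> topspace W" for w
    using continuous_map_compose [OF _ h, of X "\<lambda>t. (t, w)"] that
    by (simp add: o_def continuous_map_pairedI)
  have maps: "?\<sigma> w \<in> mapping_space X Z" if "w \<in> topspace W" for w
    using continuous_map_eq [OF cont [OF that], of "?\<sigma> w"] by (simp add: mapping_space_def)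
  show ?thesis
    unfolding compact_open_topology_def
  proof (rule continuous_on_generated_topo)
    fix S
    assume "S \<in> {{\<phi> \<in> mapping_space X Z. \<phi> ` K \<subseteq> V} |K V. compactin X K \<and> openin Z V}"
    then obtain K V where S: "S = {\<phi> \<in> mapping_space X Z. \<phi> ` K \<subseteq> V}"
      and K: "compactin X K" and V: "openin Z V"
      by blast
    have KX: "K \<subseteq> topspace X"
      using K by (rule compactin_subset_topspace)
    let ?P = "{p \<in> topspace (prod_topology X W). h p \<in> V}"
    have P: "openin (prod_topology X W) ?P"
      using h V by (rule openin_continuous_map_preimage)
    show "openin W (?\<sigma> -` S \<inter> topspace W)"
    proof (subst openin_subopen, intro ballI)
      fix w
      assume "w \<in> ?\<sigma> -` S \<inter> topspace W"
      then have w: "w \<in> topspace W" and "?\<sigma> w ` K \<subseteq> V"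
        unfolding S by blast+
      then have "K \<times> {w} \<subseteq> ?P"
        using KX by (auto simp: image_subset_iff subset_iff)
      then obtain U N where "openin W N" "K \<subseteq> U" "w \<in> N" "U \<times> N \<subseteq> ?P"
        using tube_lemma_left [OF P K w] by blast
      moreover have "N \<subseteq> ?\<sigma> -` S \<inter> topspace W"
      proof
        fix v
        assume v: "v \<in> N"
        then have "v \<in> topspace W"
          using \<open>openin W N\<close> openin_subset by blast
        moreover have "h (t, v) \<in> V" if "t \<in> K" for t
          using v that \<open>K \<subseteq> U\<close> \<open>U \<times> N \<subseteq> ?P\<close> by blast
        then have "?\<sigma> v ` K \<subseteq> V"
          using KX by auto
        ultimately show "v \<in> ?\<sigma> -` S \<inter> topspace W"
          using maps unfolding S by blast
      qed
      ultimately show "\<exists>T. openin W T \<and> w \<in> T \<and> T \<subseteq> ?\<sigma> -` S \<inter> topspace W"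
        by blast
    qed
  next
    have "mapping_space X Z = {\<phi> \<in> mapping_space X Z. \<phi> ` {} \<subseteq> {}}" "compactin X {}" "openin Z {}"
      by auto
    then show "?\<sigma> ` topspace W
        \<subseteq> \<Union> {{\<phi> \<in> mapping_space X Z. \<phi> ` K \<subseteq> V} |K V. compactin X K \<and> openin Z V}"
      using maps by blast
  qed
qed

lemma neighbourhood_base_compactin_interval:
  "neighbourhood_base_of (compactin (top_of_set {0..1::real})) (top_of_set {0..1})"
proof (rule locally_compact_imp_neighbourhood_base)
  have "compact_space (top_of_set {0..1::real})"
    by (simp add: compact_space_subtopology)
  then show "locally_compact_space (top_of_set {0..1::real})"
    by (rule compact_imp_locally_compact_space)
  show "regular_space (top_of_set {0..1::real})"
    by (simp add: regular_space_subtopology regular_space_euclidean)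
qed

text \<open>By the exponential law for the unit interval, a lift of \<open>(f, g)\<close> through the endpoint map
  is a homotopy between the two maps \<open>f \<circ> fst\<close> and \<open>g \<circ> snd\<close>.\<close>

lemma sectional_subset_iff_homotopic:
  "sectional_subset X Y Z f g A \<longleftrightarrow>
     A \<subseteq> topspace (prod_topology X Y) \<and>
     homotopic_with (\<lambda>_. True) (subtopology (prod_topology X Y) A) Z (f \<circ> fst) (g \<circ> snd)"
  (is "_ \<longleftrightarrow> ?sub \<and> homotopic_with _ ?A Z _ _")
proof -
  have "(\<exists>\<sigma>. continuous_map ?A (path_space Z) \<sigma> \<and>
          (\<forall>(x, y)\<in>A. \<sigma> (x, y) 0 = f x \<and> \<sigma> (x, y) 1 = g y)) \<longleftrightarrow>
        homotopic_with (\<lambda>_. True) ?A Z (f \<circ> fst) (g \<circ> snd)" (is "?L \<longleftrightarrow> ?R")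
    if sub: ?sub
  proof -
    have top: "topspace ?A = A"
      using sub by (rule topspace_subtopology_subset)
    show ?thesis
    proof
      assume ?L
      then obtain \<sigma> where \<sigma>: "continuous_map ?A (path_space Z) \<sigma>"
        and ends: "\<forall>(x, y)\<in>A. \<sigma> (x, y) 0 = f x \<and> \<sigma> (x, y) 1 = g y"
        by blast
      have "continuous_map (prod_topology (top_of_set {0..1}) ?A) Z (\<lambda>(t, w). \<sigma> w t)"
        using compact_open_continuous_imp_uncurry [OF neighbourhood_base_compactin_interval] \<sigma>
        by (simp add: path_space_def)
      then show ?R
        using ends top
        by (subst homotopic_with) (auto intro!: exI [where x = "\<lambda>(t, w). \<sigma> w t"])
    next
      assume ?R
      then obtain h where h: "continuous_map (prod_topology (top_of_set {0..1::real}) ?A) Z h"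
        and ends: "\<forall>w. h (0, w) = f (fst w)" "\<forall>w. h (1, w) = g (snd w)"
        unfolding homotopic_with_def o_def by blast
      have "continuous_map ?A (path_space Z) (\<lambda>w. restrict (\<lambda>t. h (t, w)) {0..1})"
        using continuous_imp_curry_compact_open [OF h] by (simp add: path_space_def)
      then show ?L
        using ends by (auto intro!: exI [where x = "\<lambda>w. restrict (\<lambda>t. h (t, w)) {0..1}"])
    qed
  qed
  then show ?thesis
    unfolding sectional_subset_def by blast
qed

lemma TC_eq_TC_H_id: "TC X = TC_H X X X id id"
proof -
  let ?XX = "prod_topology X X"
  have "(\<exists>s. continuous_map (subtopology ?XX A) (path_space X) s \<and>
             (\<forall>p\<in>A. path_endpoints (s p) = p)) \<longleftrightarrow> sectional_subset X X X id id A"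
    if "openin ?XX A" for A
    using openin_subset [OF that] unfolding sectional_subset_def path_endpoints_def
    by (simp add: split_beta prod_eq_iff)
  then have "(open_cover_upto ?XX k U \<and>
        (\<forall>i\<le>k. \<exists>s. continuous_map (subtopology ?XX (U i)) (path_space X) s \<and>
                   (\<forall>p\<in>U i. path_endpoints (s p) = p))) \<longleftrightarrow>
      (open_cover_upto ?XX k U \<and> (\<forall>i\<le>k. sectional_subset X X X id id (U i)))" for k U
    unfolding open_cover_upto_def by blast
  then show ?thesis
    unfolding TC_def TC_H_def by (simp only:)
qed

section \<open>Homotopies on disjoint unions of open sets\<close>

lemma homotopic_with_disjoint_Union:
  assumes opn: "\<And>D. D \<in> \<D> \<Longrightarrow> openin W D"
    and disj: "pairwise disjnt \<D>"
    and hom: "\<And>D. D \<in> \<D> \<Longrightarrow> homotopic_with (\<lambda>_. True) (subtopology W D) Z p q"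
  shows "homotopic_with (\<lambda>_. True) (subtopology W (\<Union>\<D>)) Z p q"
proof -
  let ?I = "top_of_set {0..1::real}"
  let ?W = "prod_topology ?I (subtopology W (\<Union>\<D>))"
  have "\<exists>h. continuous_map (prod_topology ?I (subtopology W D)) Z h \<and>
          (\<forall>w. h (0, w) = p w) \<and> (\<forall>w. h (1, w) = q w)" if "D \<in> \<D>" for D
    using hom [OF that] unfolding homotopic_with_def by blast
  then obtain h where
    h: "\<And>D. D \<in> \<D> \<Longrightarrow> continuous_map (prod_topology ?I (subtopology W D)) Z (h D)"
    and h0: "\<And>D w. D \<in> \<D> \<Longrightarrow> h D (0, w) = p w"
    and h1: "\<And>D w. D \<in> \<D> \<Longrightarrow> h D (1, w) = q w"
    by metis
  obtain k where k: "continuous_map ?W Z k"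
    and keq: "\<And>x D. \<lbrakk>D \<in> \<D>; x \<in> topspace ?W \<inter> ({0..1} \<times> D)\<rbrakk> \<Longrightarrow> k x = h D x"
  proof (rule pasting_lemma_exists [where X = ?W and I = \<D> and T = "\<lambda>D. {0..1} \<times> D" and Y = Z and f = h])
    show "topspace ?W \<subseteq> (\<Union>D\<in>\<D>. {0..1} \<times> D)"
      by auto
  next
    fix D
    assume D: "D \<in> \<D>"
    have "openin (subtopology W (\<Union>\<D>)) D"
      using opn [OF D] D by (auto simp: openin_subtopology)
    then show "openin ?W ({0..1} \<times> D)"
      by (simp add: openin_prod_Times_iff)
    have "subtopology (subtopology W (\<Union>\<D>)) D = subtopology W D"
      using D by (simp add: subtopology_subtopology Int_absorb1 Sup_upper)
    then show "continuous_map (subtopology ?W ({0..1} \<times> D)) Z (h D)"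
      using h [OF D] by (simp add: subtopology_Times subtopology_subtopology)
  next
    fix D E x
    assume "D \<in> \<D>" "E \<in> \<D>" "x \<in> topspace ?W \<inter> ({0..1} \<times> D) \<inter> ({0..1} \<times> E)"
    then have "D = E"
      using disj by (fastforce simp: pairwise_def disjnt_def)
    then show "h D x = h E x"
      by simp
  qed blast
  have "k (0, w) = p w" "k (1, w) = q w" if "w \<in> topspace (subtopology W (\<Union>\<D>))" for w
  proof -
    from that obtain D where "D \<in> \<D>" "w \<in> D"
      by auto
    then show "k (0, w) = p w" "k (1, w) = q w"
      using keq [of D "(0, w)"] keq [of D "(1, w)"] h0 h1 that by auto
  qed
  with k show ?thesis
    by (subst homotopic_with) auto
qed

section \<open>Combining two open covers of a normal space\<close>

text \<open>The induction adds the sets one by one, so the functions are required to attain 1 only on a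
  closed set \<open>K\<close> that the sets cover.\<close>

lemma normal_space_finite_cover_functions:
  assumes W: "normal_space W" and K: "closedin W K" and fin: "finite I"
    and A: "\<And>i. i \<in> I \<Longrightarrow> openin W (A i)" and cover: "K \<subseteq> (\<Union>i\<in>I. A i)"
  shows "\<exists>a. (\<forall>i\<in>I. continuous_map W euclideanreal (a i) \<and>
                    (\<forall>w\<in>topspace W. 0 \<le> a i w \<and> a i w \<le> 1 \<and> (w \<notin> A i \<longrightarrow> a i w = 0))) \<and>
             (\<forall>w\<in>K. \<exists>i\<in>I. a i w = (1::real))"
  using fin K A cover
proof (induction I arbitrary: K rule: finite_induct)
  case empty
  then show ?case by auto
next
  case (insert j I)
  let ?L = "K - (\<Union>i\<in>I. A i)"
  have L: "closedin W ?L"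
    using insert.prems by (intro closedin_diff) auto
  have "closedin W (topspace W - A j)"
    using insert.prems by blast
  moreover have "disjnt (topspace W - A j) ?L"
    using insert.prems by (auto simp: disjnt_def)
  ultimately obtain u where u: "continuous_map W (top_of_set {0..1::real}) u"
    and u0: "u ` (topspace W - A j) \<subseteq> {0}" and u1: "u ` ?L \<subseteq> {1}"
    using Urysohn_lemma [OF W _ L, of "topspace W - A j" 0 1] by auto
  have ur: "continuous_map W euclideanreal u" and u01: "\<And>w. w \<in> topspace W \<Longrightarrow> 0 \<le> u w \<and> u w \<le> 1"
    using u by (auto simp: continuous_map_in_subtopology)
  \<comment> \<open>The function for \<open>A j\<close> equals 1 on a whole neighbourhood of the part of \<open>K\<close> outside the other
    sets, so that the rest \<open>?K'\<close> of \<open>K\<close> is closed and covered by the other sets.\<close>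
  let ?aj = "\<lambda>w. min 1 (2 * u w)"
  let ?K' = "K \<inter> {w \<in> topspace W. u w \<in> {..1/2}}"
  have "closedin W {w \<in> topspace W. u w \<in> {..1/2}}"
    using ur by (rule closedin_continuous_map_preimage) auto
  then have "closedin W ?K'"
    using insert.prems by blast
  moreover have "?K' \<subseteq> (\<Union>i\<in>I. A i)"
    using u1 by fastforce
  ultimately obtain a where
    a: "\<forall>i\<in>I. continuous_map W euclideanreal (a i) \<and>
          (\<forall>w\<in>topspace W. 0 \<le> a i w \<and> a i w \<le> 1 \<and> (w \<notin> A i \<longrightarrow> a i w = 0))"
    and aK: "\<forall>w\<in>?K'. \<exists>i\<in>I. a i w = (1::real)"
    using insert.IH [of ?K'] insert.prems by auto
  have "continuous_map W euclideanreal ?aj"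
    by (intro continuous_intros ur) auto
  moreover have "0 \<le> ?aj w \<and> ?aj w \<le> 1 \<and> (w \<notin> A j \<longrightarrow> ?aj w = 0)" if "w \<in> topspace W" for w
    using u01 [OF that] u0 that by auto
  moreover have "\<exists>i\<in>insert j I. (a(j := ?aj)) i w = 1" if "w \<in> K" for w
  proof (cases "w \<in> ?K'")
    case True
    then obtain i where "i \<in> I" "a i w = 1"
      using aK by blast
    with insert.hyps show ?thesis
      by (intro bexI [of _ i]) auto
  next
    case False
    then have "?aj w = 1"
      using that closedin_subset [OF insert.prems(1)] by auto
    then show ?thesis
      by simp
  qed
  ultimately show ?case
    using a insert.hyps by (intro exI [of _ "a(j := ?aj)"]) auto
qed

text \<open>The points at which the values of the functions indexed by \<open>P\<close> are positive and exceed all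
  values of the functions indexed by \<open>I - P\<close>.\<close>

definition dominance_set :: "'a topology \<Rightarrow> 'i set \<Rightarrow> ('i \<Rightarrow> 'a \<Rightarrow> real) \<Rightarrow> 'i set \<Rightarrow> 'a set"
  where "dominance_set W I c P =
    {w \<in> topspace W. \<forall>i\<in>P. 0 < c i w \<and> (\<forall>j\<in>I - P. c j w < c i w)}"

lemma openin_dominance_set:
  assumes "finite I" "P \<subseteq> I" and c: "\<And>i. i \<in> I \<Longrightarrow> continuous_map W euclideanreal (c i)"
  shows "openin W (dominance_set W I c P)"
proof -
  have pos: "openin W {w \<in> topspace W. 0 < c i w}" if "i \<in> P" for i
    using openin_continuous_map_preimage [OF c, of i "{0<..}"] that assms by auto
  have less: "openin W {w \<in> topspace W. c j w < c i w}" if "i \<in> P" "j \<in> I - P" for i j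
    using openin_continuous_map_preimage
        [OF continuous_map_diff [OF c c], of i j "{0<..}"] that assms by auto
  have "openin W (topspace W \<inter> (\<Inter>j\<in>I - P. {w \<in> topspace W. c j w < c i w}))"
    if "i \<in> P" for i
    using assms that by (intro openin_Int_Inter) (auto intro: less)
  then have "openin W (topspace W \<inter>
      (\<Inter>i\<in>P. {w \<in> topspace W. 0 < c i w} \<inter>
        (topspace W \<inter> (\<Inter>j\<in>I - P. {w \<in> topspace W. c j w < c i w}))))"
    using assms finite_subset [of P I] pos by (intro openin_Int_Inter) auto
  also have "topspace W \<inter>
      (\<Inter>i\<in>P. {w \<in> topspace W. 0 < c i w} \<inter>
        (topspace W \<inter> (\<Inter>j\<in>I - P. {w \<in> topspace W. c j w < c i w})))
      = dominance_set W I c P"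
    unfolding dominance_set_def by auto
  finally show ?thesis .
qed

text \<open>At a point of two dominance sets, each of the two index sets collects the largest values, so
  one contains the other; equal cardinalities then force them to be equal.\<close>

lemma disjnt_dominance_set:
  assumes "finite I" "P \<subseteq> I" "Q \<subseteq> I" "card P = card Q" "P \<noteq> Q"
  shows "disjnt (dominance_set W I c P) (dominance_set W I c Q)"
proof -
  have fin: "finite P" "finite Q"
    using assms finite_subset by auto
  then have "\<not> P \<subseteq> Q" "\<not> Q \<subseteq> P"
    using assms card_subset_eq by metis+
  then obtain i j where i: "i \<in> P - Q" and j: "j \<in> Q - P"
    by blast
  have False if "w \<in> dominance_set W I c P" "w \<in> dominance_set W I c Q" for w
  proof -
    have "c j w < c i w" "c i w < c j w"
      using that i j assms(2,3) unfolding dominance_set_def by blast+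
    then show False
      by simp
  qed
  then show ?thesis
    unfolding disjnt_def by blast
qed

text \<open>Each \<open>\<D> l\<close> consists of the dominance sets of the index sets with \<open>l + 2\<close> elements that meet
  both families of indices. There are \<open>m + 1\<close> indices for \<open>A\<close> and \<open>n + 1\<close> for \<open>B\<close>, so the index sets
  that meet both have between \<open>2\<close> and \<open>m + n + 2\<close> elements, which leaves \<open>m + n + 1\<close> possible
  cardinalities.\<close>

lemma normal_space_combine_covers:
  assumes W: "normal_space W" and A: "open_cover_upto W m A" and B: "open_cover_upto W n B"
  obtains \<D> where "open_cover_upto W (m + n) (\<lambda>l. \<Union>(\<D> l))"
    and "\<And>l. pairwise disjnt (\<D> l)"
    and "\<And>l D. D \<in> \<D> l \<Longrightarrow> openin W D"
    and "\<And>l D. D \<in> \<D> l \<Longrightarrow> \<exists>i\<le>m. \<exists>j\<le>n. D \<subseteq> A i \<inter> B j"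
proof -
  have fns: "\<exists>a. (\<forall>i\<le>k. continuous_map W euclideanreal (a i)) \<and>
              (\<forall>i\<le>k. \<forall>w\<in>topspace W. a i w \<le> (1::real) \<and> (w \<notin> C i \<longrightarrow> a i w = 0)) \<and>
              (\<forall>w\<in>topspace W. \<exists>i\<le>k. a i w = 1)" if "open_cover_upto W k C" for k C
    using normal_space_finite_cover_functions [OF W closedin_topspace, of "{..k}" C] that
    unfolding open_cover_upto_def by (auto elim!: ex_forward)
  obtain a where a: "\<forall>i\<le>m. continuous_map W euclideanreal (a i)"
    and a01: "\<forall>i\<le>m. \<forall>w\<in>topspace W. a i w \<le> (1::real) \<and> (w \<notin> A i \<longrightarrow> a i w = 0)"
    and aex: "\<forall>w\<in>topspace W. \<exists>i\<le>m. a i w = 1"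
    using fns [OF A] by (elim exE conjE)
  obtain b where b: "\<forall>j\<le>n. continuous_map W euclideanreal (b j)"
    and b01: "\<forall>j\<le>n. \<forall>w\<in>topspace W. b j w \<le> (1::real) \<and> (w \<notin> B j \<longrightarrow> b j w = 0)"
    and bex: "\<forall>w\<in>topspace W. \<exists>j\<le>n. b j w = 1"
    using fns [OF B] by (elim exE conjE)
  define I where "I = {..m} <+> {..n}"
  \<comment> \<open>the functions of both covers, compared with one another as a single family\<close>
  define c where "c = case_sum a b"
  define \<P> where "\<P> l = {P. P \<subseteq> I \<and> card P = l + 2 \<and> (\<exists>i. Inl i \<in> P) \<and> (\<exists>j. Inr j \<in> P)}" for l
  define \<D> where "\<D> l = dominance_set W I c ` \<P> l" for l
  have finI: "finite I" and cardI: "card I = m + n + 2"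
    by (auto simp: I_def card_Plus)
  have c: "continuous_map W euclideanreal (c i)" if "i \<in> I" for i
    using that a b by (auto simp: I_def c_def)
  have c1: "c i w \<le> 1" if "i \<in> I" "w \<in> topspace W" for i w
    using that a01 b01 by (auto simp: I_def c_def)
  have opn: "openin W D" if "D \<in> \<D> l" for D l
    using that openin_dominance_set [OF finI _ c] by (auto simp: \<D>_def \<P>_def)
  show ?thesis
  proof
    show "open_cover_upto W (m + n) (\<lambda>l. \<Union>(\<D> l))"
      unfolding open_cover_upto_def
    proof (intro conjI allI impI subset_antisym)
      show "openin W (\<Union>(\<D> l))" for l
        using opn by blast
      then show "(\<Union>l\<le>m + n. \<Union>(\<D> l)) \<subseteq> topspace W"
        using openin_subset by blast
      show "topspace W \<subseteq> (\<Union>l\<le>m + n. \<Union>(\<D> l))"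
      proof
        fix w
        assume w: "w \<in> topspace W"
        \<comment> \<open>As 1 is the largest possible value, \<open>w\<close> lies in the dominance set of \<open>P\<close>.\<close>
        define P where "P = {i \<in> I. c i w = 1}"
        obtain i j where "i \<le> m" "a i w = 1" "j \<le> n" "b j w = 1"
          using aex bex w by blast
        then have ij: "Inl i \<in> P" "Inr j \<in> P"
          by (auto simp: P_def I_def c_def)
        have PI: "P \<subseteq> I"
          by (auto simp: P_def)
        have "card {Inl i, Inr j} \<le> card P"
          using ij PI finI finite_subset by (intro card_mono) auto
        moreover have "card P \<le> m + n + 2"
          using card_mono [OF finI PI] cardI by simp
        ultimately have "card P - 2 \<le> m + n" "card P = card P - 2 + 2"
          by auto
        moreover have "w \<in> dominance_set W I c P"
          using w c1 by (fastforce simp: dominance_set_def P_def order_less_le)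
        ultimately show "w \<in> (\<Union>l\<le>m + n. \<Union>(\<D> l))"
          using ij PI unfolding \<D>_def \<P>_def by blast
      qed
    qed
    show "pairwise disjnt (\<D> l)" for l
      unfolding pairwise_def \<D>_def \<P>_def
      by (clarify, rule disjnt_dominance_set [OF finI]) auto
    show "openin W D" if "D \<in> \<D> l" for D l
      using that by (rule opn)
    show "\<exists>i\<le>m. \<exists>j\<le>n. D \<subseteq> A i \<inter> B j" if "D \<in> \<D> l" for D l
    proof -
      obtain P i j where D: "D = dominance_set W I c P" and "P \<subseteq> I" and ij: "Inl i \<in> P" "Inr j \<in> P"
        using \<open>D \<in> \<D> l\<close> by (auto simp: \<D>_def \<P>_def)
      then have le: "i \<le> m" "j \<le> n"
        by (auto simp: I_def)
      have "w \<in> A i \<inter> B j" if "w \<in> D" for w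
      proof -
        have "w \<in> topspace W" "0 < a i w" "0 < b j w"
          using that ij unfolding D dominance_set_def by (auto simp: c_def)
        then show ?thesis
          using a01 b01 le by force
      qed
      with le show ?thesis
        by blast
    qed
  qed
qed

section \<open>The two inequalities\<close>

lemma Inf_enat_attained:
  assumes "Inf {enat k |k. P k} = enat n"
  shows "P n"
proof -
  have "{enat k |k. P k} \<noteq> {}"
    using assms by (metis Inf_enat_def enat.distinct(1))
  then have "Inf {enat k |k. P k} \<in> {enat k |k. P k}"
    by (metis (mono_tags, lifting) Inf_enat_def LeastI_ex ex_in_conv)
  with assms show ?thesis
    by auto
qed

lemma Inf_enat_upper:
  assumes "P n"
  shows "Inf {enat k |k. P k} \<le> enat n"
  using assms by (intro Inf_lower) blast

lemma homotopic_distance_le_TC_H: "homotopic_distance X Z f g \<le> TC_H X X Z f g"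
proof (cases "TC_H X X Z f g")
  case (enat k)
  let ?XX = "prod_topology X X"
  let ?d = "\<lambda>x. (x, x)"
  have d: "continuous_map X ?XX ?d"
    by (intro continuous_map_pairedI) auto
  from Inf_enat_attained [OF enat [unfolded TC_H_def]]
  obtain U where U: "open_cover_upto ?XX k U"
    and sec: "\<forall>i\<le>k. sectional_subset X X Z f g (U i)"
    by blast
  define V where "V i = {x \<in> topspace X. (x, x) \<in> U i}" for i
  have "open_cover_upto X k V"
    using U openin_continuous_map_preimage [OF d]
    unfolding open_cover_upto_def V_def by (auto simp: set_eq_iff)
  moreover have "homotopic_with (\<lambda>_. True) (subtopology X (V i)) Z f g" if "i \<le> k" for i
  proof -
    have dV: "continuous_map (subtopology X (V i)) (subtopology ?XX (U i)) ?d"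
      using d by (auto simp: continuous_map_in_subtopology continuous_map_from_subtopology V_def)
    have homU: "homotopic_with (\<lambda>_. True) (subtopology ?XX (U i)) Z (f \<circ> fst) (g \<circ> snd)"
      using sec that by (simp add: sectional_subset_iff_homotopic)
    have "homotopic_with (\<lambda>_. True) (subtopology X (V i)) Z (f \<circ> fst \<circ> ?d) (g \<circ> snd \<circ> ?d)"
      by (rule homotopic_with_compose_continuous_map_right [OF homU dV]) simp
    then show ?thesis
      by (simp add: o_def)
  qed
  ultimately have "homotopic_distance X Z f g \<le> enat k"
    unfolding homotopic_distance_def by (intro Inf_enat_upper) blast
  then show ?thesis
    by (simp add: enat)
qed simp

lemma TC_H_le_homotopic_distance_plus_TC:
  assumes g: "continuous_map X Z g" and normal: "normal_space (prod_topology X X)"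
  shows "TC_H X X Z f g \<le> homotopic_distance X Z f g + TC X"
proof (cases "homotopic_distance X Z f g")
  case m: (enat m)
  show ?thesis
  proof (cases "TC X")
    case n: (enat n)
    let ?XX = "prod_topology X X"
    from Inf_enat_attained [OF m [unfolded homotopic_distance_def]]
    obtain U where U: "open_cover_upto X m U"
      and homU: "\<And>i. i \<le> m \<Longrightarrow> homotopic_with (\<lambda>_. True) (subtopology X (U i)) Z f g"
      by blast
    from Inf_enat_attained [OF n [unfolded TC_eq_TC_H_id TC_H_def]]
    obtain V where V: "open_cover_upto ?XX n V"
      and secV: "\<And>j. j \<le> n \<Longrightarrow> sectional_subset X X X id id (V j)"
      by blast
    define A where "A i = U i \<times> topspace X" for i
    have "open_cover_upto ?XX m A"
      using U unfolding open_cover_upto_def A_def by (auto simp: openin_prod_Times_iff)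
    then obtain \<D> where cover: "open_cover_upto ?XX (m + n) (\<lambda>l. \<Union>(\<D> l))"
      and disj: "\<And>l. pairwise disjnt (\<D> l)"
      and opn: "\<And>l D. D \<in> \<D> l \<Longrightarrow> openin ?XX D"
      and sub: "\<And>l D. D \<in> \<D> l \<Longrightarrow> \<exists>i\<le>m. \<exists>j\<le>n. D \<subseteq> A i \<inter> V j"
      using normal_space_combine_covers [OF normal _ V] by metis
    have hom: "homotopic_with (\<lambda>_. True) (subtopology ?XX D) Z (f \<circ> fst) (g \<circ> snd)"
      if D: "D \<in> \<D> l" for D l
    proof -
      obtain i j where i: "i \<le> m" "D \<subseteq> A i" and j: "j \<le> n" "D \<subseteq> V j"
        using sub [OF D] by blast
      have fstD: "continuous_map (subtopology ?XX D) (subtopology X (U i)) fst"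
        using i by (auto simp: continuous_map_in_subtopology continuous_map_fst
            continuous_map_from_subtopology A_def)
      have fg: "homotopic_with (\<lambda>_. True) (subtopology ?XX D) Z (f \<circ> fst) (g \<circ> fst)"
        by (rule homotopic_with_compose_continuous_map_right [OF homU [OF i(1)] fstD]) simp
      have "homotopic_with (\<lambda>_. True) (subtopology ?XX (V j)) X fst snd"
        using secV [OF j(1)] by (simp add: sectional_subset_iff_homotopic)
      then have "homotopic_with (\<lambda>_. True) (subtopology (subtopology ?XX (V j)) D) X fst snd"
        by (rule homotopic_from_subtopology)
      then have "homotopic_with (\<lambda>_. True) (subtopology ?XX D) X fst snd"
        using j by (simp add: subtopology_subtopology Int_absorb1)
      then have "homotopic_with (\<lambda>_. True) (subtopology ?XX D) Z (g \<circ> fst) (g \<circ> snd)"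
        by (rule homotopic_with_compose_continuous_map_left [OF _ g]) simp
      with fg show ?thesis
        by (rule homotopic_with_trans)
    qed
    have "sectional_subset X X Z f g (\<Union>(\<D> l))" for l
      unfolding sectional_subset_iff_homotopic
    proof
      show "\<Union>(\<D> l) \<subseteq> topspace ?XX"
        using opn openin_subset by blast
      show "homotopic_with (\<lambda>_. True) (subtopology ?XX (\<Union>(\<D> l))) Z (f \<circ> fst) (g \<circ> snd)"
        using opn disj hom by (rule homotopic_with_disjoint_Union)
    qed
    with cover have "TC_H X X Z f g \<le> enat (m + n)"
      unfolding TC_H_def by (intro Inf_enat_upper) blast
    then show ?thesis
      by (simp add: m n)
  qed simp
qed simp

theorem proposition7p2:
  fixes X :: "'a topology" and Z :: "'b topology" and f g :: "'a \<Rightarrow> 'b"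
  assumes "continuous_map X Z f" and "continuous_map X Z g"
  shows "homotopic_distance X Z f g \<le> TC_H X X Z f g \<and>
    (normal_space (prod_topology X X) \<and> Hausdorff_space (prod_topology X X) \<longrightarrow>
       homotopic_distance X Z f g \<le> TC_H X X Z f g \<and>
       TC_H X X Z f g \<le> homotopic_distance X Z f g + TC X)"
  using assms homotopic_distance_le_TC_H TC_H_le_homotopic_distance_plus_TC by blast

end
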